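(* Algorithm MarkAndPick is $\phi$-competitive, where $\phi=(1+\sqrt5)/2$, for dynamic queues in which item weights are non-decreasing along the queue, i.e. at any time, for any two active items $a,b$ with $a\lhd b$ we have $w_a\le w_b$.
   Context: Dynamic set problem: each item $x$ has a weight $w_x\ge 0$; time proceeds in steps; before each step items may be inserted into or deleted from a dynamic set $\mathcal{S}$; an item is active if inserted and not yet deleted; at each step an algorithm may collect at most one active item it has not collected before (pending items); the gain is the total weight collected. A deterministic online algorithm is $R$-competitive if on every instance its gain is at least $\mathrm{OPT}/R$ ($\mathrm{OPT}$ = maximum achievable gain). Dynamic queue: $\mathcal{S}$ is a linearly ordered list (order $\lhd$); items may be inserted at any position, but only a prefix of the current list may be deleted. Algorithm MarkAndPick: all items are initially unmarked. At each step $t=1,2,\dots$: if there is no pending item, do nothing; otherwise let $h$ be the heaviest unmarked item among all items inserted so far (not necessarily active), mark $h$, and collect the earliest (in queue order) pending item $i$ with $w_i\ge w_h/\phi$.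
   Formalization: Weights are required to be non-decreasing along the queue order on all items inserted so far, deleted ones first, not only between two active items; with active items alone the claim is false, since h may be a deleted item heavier than everything active. *)

theory Defs
  imports Complex_Main
begin

section \<open>Dynamic queues\<close>

datatype 'a queue_op =
    Insert nat 'a  \<comment> \<open>insert an item behind the first \<open>p\<close> items of the current queue\<close>
  | Delete nat     \<comment> \<open>delete the first \<open>k\<close> items of the current queue\<close>

text \<open>The \<open>t\<close>-th entry of an input lists the operations performed before step \<open>t\<close>;
  the length of the input is the number of steps. Steps are numbered from 0.\<close>

type_synonym 'a input = "'a queue_op list list"

text \<open>A state is a pair \<open>(D, Q)\<close>: \<open>Q\<close> is the list of active items in queue order, \<open>D\<close> the list of
  items deleted so far. Since only prefixes of the queue are deleted and they are appended
  to \<open>D\<close>, the list \<open>D @ Q\<close> is the queue order on all items inserted so far.\<close>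

type_synonym 'a queue_state = "'a list \<times> 'a list"

fun apply_op :: "'a queue_op \<Rightarrow> 'a queue_state \<Rightarrow> 'a queue_state" where
  "apply_op (Insert p x) (D, Q) = (D, take p Q @ x # drop p Q)"
| "apply_op (Delete k) (D, Q) = (D @ take k Q, drop k Q)"

definition state_after :: "'a queue_op list \<Rightarrow> 'a queue_state" where
  "state_after ops = fold apply_op ops ([], [])"

definition state_at :: "'a input \<Rightarrow> nat \<Rightarrow> 'a queue_state" where
  "state_at I t = state_after (concat (take (Suc t) I))"

text \<open>An item is inserted at most once.\<close>

definition valid_input :: "'a input \<Rightarrow> bool" where
  "valid_input I \<longleftrightarrow>
     (\<forall>n. let (D, Q) = state_after (take n (concat I)) in distinct (D @ Q))"

text \<open>At any time, i.e. after any number \<open>n\<close> of operations, weights are non-decreasing along the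
  queue order. The order compared against includes the deleted prefix \<open>D\<close>. If
  only \<open>Q\<close> had to be sorted, items could be inserted that are lighter than all deleted ones; then
  no pending item need reach the threshold of MarkAndPick, and even on inputs where one always
  does, MarkAndPick would not be \<open>\<phi>\<close>-competitive: let four items of weight 1 be active
  in the first step only, and before each of the next three steps let an item of weight 0.61,
  which is active in that step only, be inserted in front, and an item of weight 0.62, which stays
  active for ever, at the end. MarkAndPick collects \<open>1 + 3 * 0.62 = 2.86\<close>, the optimum is
  \<open>1 + 3 * (0.61 + 0.62) = 4.69\<close>.\<close>

definition nondecreasing_weights :: "('a \<Rightarrow> real) \<Rightarrow> 'a input \<Rightarrow> bool" where
  "nondecreasing_weights w I \<longleftrightarrow>
     (\<forall>n. let (D, Q) = state_after (take n (concat I)) in sorted (map w (D @ Q)))"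


section \<open>Collecting items and competitiveness\<close>

text \<open>The \<open>t\<close>-th entry of a schedule is the item collected in step \<open>t\<close>, if any.\<close>

type_synonym 'a schedule = "'a option list"

definition feasible :: "'a input \<Rightarrow> 'a schedule \<Rightarrow> bool" where
  "feasible I C \<longleftrightarrow> length C = length I \<and>
     (\<forall>t<length I. \<forall>x. C ! t = Some x \<longrightarrow>
        x \<in> set (snd (state_at I t)) \<and> (\<forall>s<t. C ! s \<noteq> Some x))"

definition gain :: "('a \<Rightarrow> real) \<Rightarrow> 'a schedule \<Rightarrow> real" where
  "gain w C = (\<Sum>c\<leftarrow>C. case c of None \<Rightarrow> 0 | Some x \<Rightarrow> w x)"

definition OPT :: "('a \<Rightarrow> real) \<Rightarrow> 'a input \<Rightarrow> real" where
  "OPT w I = Max (gain w ` {C. feasible I C})"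

definition competitive_on ::
  "(('a \<Rightarrow> real) \<times> 'a input) set \<Rightarrow> real \<Rightarrow> (('a \<Rightarrow> real) \<Rightarrow> 'a input \<Rightarrow> 'a schedule) \<Rightarrow> bool" where
  "competitive_on K R A \<longleftrightarrow>
     (\<forall>(w, I)\<in>K. feasible I (A w I) \<and> gain w (A w I) \<ge> OPT w I / R)"

definition nondecreasing_queues :: "(('a \<Rightarrow> real) \<times> 'a input) set" where
  "nondecreasing_queues =
     {(w, I). (\<forall>x. w x \<ge> 0) \<and> valid_input I \<and> nondecreasing_weights w I}"


section \<open>Algorithm MarkAndPick\<close>

definition golden_ratio :: real where
  "golden_ratio = (1 + sqrt 5) / 2"

text \<open>The parameter \<open>sel w U\<close> is the heaviest item of \<open>U\<close>, i.e. \<open>sel\<close> is the rule that breaks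
  ties between items of equal weight.\<close>

definition heaviest_rule :: "(('a \<Rightarrow> real) \<Rightarrow> 'a set \<Rightarrow> 'a) \<Rightarrow> bool" where
  "heaviest_rule sel \<longleftrightarrow>
     (\<forall>w U. finite U \<and> U \<noteq> {} \<longrightarrow> is_arg_max w (\<lambda>x. x \<in> U) (sel w U))"

text \<open>The marked items and the schedule after the first \<open>t\<close> steps. If there were no
  pending item of weight at least \<open>w h / \<phi>\<close>, \<open>find\<close> would return \<open>None\<close> and nothing would be
  collected.\<close>

fun mp_run :: "(('a \<Rightarrow> real) \<Rightarrow> 'a set \<Rightarrow> 'a) \<Rightarrow> ('a \<Rightarrow> real) \<Rightarrow> 'a input \<Rightarrow> nat
    \<Rightarrow> 'a set \<times> 'a schedule" where
  "mp_run sel w I 0 = ({}, [])"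
| "mp_run sel w I (Suc t) =
     (let (M, C) = mp_run sel w I t;
          (D, Q) = state_at I t;
          pending = filter (\<lambda>x. Some x \<notin> set C) Q
      in if pending = [] then (M, C @ [None])
         else let h = sel w (set (D @ Q) - M)
              in (insert h M, C @ [find (\<lambda>i. w i \<ge> w h / golden_ratio) pending]))"

definition mark_and_pick ::
  "(('a \<Rightarrow> real) \<Rightarrow> 'a set \<Rightarrow> 'a) \<Rightarrow> ('a \<Rightarrow> real) \<Rightarrow> 'a input \<Rightarrow> 'a schedule" where
  "mark_and_pick sel w I = snd (mp_run sel w I (length I))"

end

theory Submission
  imports Defs
begin

text \<open>Call a step idle if no item is pending, and an item retained if it is active at some idle
  step; retained items are collected by MarkAndPick, so the optimum may have them for free. Let
  \<open>h\<^sub>s\<close> and \<open>c\<^sub>s\<close> be the items marked and collected in a non-idle step \<open>s\<close>. Since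
  \<open>\<phi> = 1 + 1 / \<phi>\<close> and \<open>w h\<^sub>s \<le> \<phi> * w c\<^sub>s\<close>, it suffices to bound the weight of the other
  items of the optimum by the sum of the credits, which are \<open>w c\<^sub>s / \<phi>\<close> if \<open>c\<^sub>s\<close> is retained and
  \<open>w h\<^sub>s\<close> otherwise. This is done for each threshold \<open>\<theta>\<close> separately, by counting: the optimum
  takes at most as many non-retained items of weight at least \<open>\<theta>\<close> as there are credits of at
  least \<open>\<theta>\<close>. In a step that earns no credit there are two ways to conclude that the items still
  within reach of the optimum have been paid for: either \<open>w h\<^sub>s < \<theta>\<close>, and then all relevant items
  are marked, or \<open>c\<^sub>s\<close> is retained and \<open>w h\<^sub>s < \<phi> * \<theta>\<close>, and then all relevant active items, which
  precede \<open>c\<^sub>s\<close> in the queue, are collected. Each of the two is backed by an invariant.\<close>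

section \<open>Comparing sums level by level\<close>

text \<open>Match a maximal \<open>x\<close> of \<open>R\<close> with some \<open>s\<close> such
  that \<open>f x \<le> g s\<close> and remove both: every level up to \<open>f x\<close> loses one
  element on either side, and above \<open>f x\<close> nothing of \<open>R\<close> remains, so the
  counting hypothesis survives. If \<open>f x \<le> 0\<close>, the signs of the two sums
  decide.\<close>

lemma sum_le_sum_if_card_levels_le:
  fixes f :: "'a \<Rightarrow> real" and g :: "'b \<Rightarrow> real"
  assumes "finite R" "finite S" "\<And>s. s \<in> S \<Longrightarrow> 0 \<le> g s"
    and "\<And>\<theta>. \<theta> > 0 \<Longrightarrow> card {x\<in>R. \<theta> \<le> f x} \<le> card {s\<in>S. \<theta> \<le> g s}"
  shows "sum f R \<le> sum g S"
  using assms
proof (induction "card R" arbitrary: R S)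
  case 0
  then have "R = {}" by simp
  then show ?case using 0 by (simp add: sum_nonneg)
next
  case (Suc k)
  then have "R \<noteq> {}" by auto
  moreover have fR: "finite (f ` R)" using Suc.prems(1) by simp
  ultimately obtain x where "x \<in> R" "f x = Max (f ` R)"
    using Max_in[of "f ` R"] by (metis imageE image_is_empty)
  with fR have x: "x \<in> R" "\<And>y. y \<in> R \<Longrightarrow> f y \<le> f x" by auto
  show ?case
  proof (cases "f x > 0")
    case False
    then have "sum f R \<le> 0" using x by (intro sum_nonpos) force
    also have "0 \<le> sum g S" using Suc.prems by (simp add: sum_nonneg)
    finally show ?thesis .
  next
    case True
    have "0 < card {y\<in>R. f x \<le> f y}"
      using x Suc.prems(1) by (auto simp: card_gt_0_iff)
    then have "card {s\<in>S. f x \<le> g s} \<noteq> 0" using Suc.prems(4)[OF True] by linarith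
    then have "{s\<in>S. f x \<le> g s} \<noteq> {}" by (metis card.empty)
    then obtain s where s: "s \<in> S" "f x \<le> g s" by blast
    have "sum f (R - {x}) \<le> sum g (S - {s})"
    proof (rule Suc.hyps(1))
      show "k = card (R - {x})" using Suc.hyps(2) x(1) Suc.prems(1) by simp
      fix \<theta> :: real assume "\<theta> > 0"
      show "card {y\<in>R - {x}. \<theta> \<le> f y} \<le> card {r\<in>S - {s}. \<theta> \<le> g r}"
      proof (cases "\<theta> \<le> f x")
        case True
        have "{y\<in>R - {x}. \<theta> \<le> f y} = {y\<in>R. \<theta> \<le> f y} - {x}"
          "{r\<in>S - {s}. \<theta> \<le> g r} = {r\<in>S. \<theta> \<le> g r} - {s}" by auto
        then show ?thesis
          using Suc.prems(4)[OF \<open>\<theta> > 0\<close>] True x(1) s Suc.prems(1,2) by (simp add: diff_le_mono)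
      next
        case False
        then have "{y\<in>R - {x}. \<theta> \<le> f y} = {}" using x(2) by force
        then show ?thesis by (metis card.empty le0)
      qed
    qed (use Suc.prems in auto)
    then show ?thesis
      using s x(1) Suc.prems(1,2) by (simp add: sum.remove[of R x] sum.remove[of S s])
  qed
qed

lemma golden_ratio_gt_1: "golden_ratio > 1"
  unfolding golden_ratio_def using real_less_rsqrt[of 1 5] by simp

lemma golden_ratio_mult: "golden_ratio * x = x + x / golden_ratio"
proof -
  have "golden_ratio * golden_ratio = golden_ratio + 1"
    unfolding golden_ratio_def by (simp add: field_simps)
  then have "golden_ratio * golden_ratio * x = (golden_ratio + 1) * x" by simp
  then show ?thesis using golden_ratio_gt_1 by (simp add: field_simps)
qed

section \<open>Runs of MarkAndPick\<close>

text \<open>The queue order is given by positions that do not change over time. \<open>Mk t\<close> and \<open>Col t\<close> are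
  the items marked and collected before step \<open>t\<close>. That the items used in a step exist is not
  assumed: \<open>h t\<close> and \<open>c t\<close> are only constrained if there are suitable items.\<close>

locale mark_and_pick_run =
  fixes w :: "'a \<Rightarrow> real" and pos :: "'a \<Rightarrow> nat"
    and Ins Act :: "nat \<Rightarrow> 'a set"
    and Mk Col :: "nat \<Rightarrow> 'a set"
    and h c :: "nat \<Rightarrow> 'a"
  assumes w_nonneg: "0 \<le> w x"
    and finite_Ins: "finite (Ins t)"
    and Act_subset_Ins: "Act t \<subseteq> Ins t"
    and Ins_mono: "t \<le> t' \<Longrightarrow> Ins t \<subseteq> Ins t'"
    and deleted: "x \<in> Ins t \<Longrightarrow> x \<notin> Act t \<Longrightarrow> t \<le> t' \<Longrightarrow> x \<notin> Act t'"
    and deleted_before: "x \<in> Ins t \<Longrightarrow> x \<notin> Act t \<Longrightarrow> y \<in> Act t \<Longrightarrow> pos x < pos y"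
    and w_mono: "x \<in> Ins t \<Longrightarrow> y \<in> Ins t \<Longrightarrow> pos x < pos y \<Longrightarrow> w x \<le> w y"
    and Mk_0: "Mk 0 = {}"
    and Col_0: "Col 0 = {}"
    and idle_step: "Act t \<subseteq> Col t \<Longrightarrow> Mk (Suc t) = Mk t \<and> Col (Suc t) = Col t"
    and mark_heaviest: "\<not> Act t \<subseteq> Col t \<Longrightarrow> Ins t - Mk t \<noteq> {} \<Longrightarrow>
      h t \<in> Ins t - Mk t \<and> (\<forall>x\<in>Ins t - Mk t. w x \<le> w (h t))"
    and Mk_Suc: "\<not> Act t \<subseteq> Col t \<Longrightarrow> Mk (Suc t) = insert (h t) (Mk t)"
    and pick_earliest: "\<not> Act t \<subseteq> Col t \<Longrightarrow> \<exists>y\<in>Act t - Col t. w (h t) / golden_ratio \<le> w y \<Longrightarrow>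
      c t \<in> Act t - Col t \<and> w (h t) / golden_ratio \<le> w (c t) \<and>
      (\<forall>y\<in>Act t - Col t. w (h t) / golden_ratio \<le> w y \<longrightarrow> pos (c t) \<le> pos y) \<and>
      Col (Suc t) = insert (c t) (Col t)"
begin

abbreviation idle :: "nat \<Rightarrow> bool" where
  "idle t \<equiv> Act t \<subseteq> Col t"

text \<open>The count over all levels says that the k-th heaviest collected item is at most as heavy
  as the k-th heaviest marked one. As an invariant, it ensures that every busy step finds an item to
  mark and an item to pick.\<close>

definition marks_dominate :: "nat \<Rightarrow> bool" where
  "marks_dominate t \<longleftrightarrow> Mk t \<subseteq> Ins t \<and> Col t \<subseteq> Ins t \<and> card (Col t) = card (Mk t) \<and>
     (\<forall>\<theta>. card {x\<in>Col t. \<theta> \<le> w x} \<le> card {x\<in>Mk t. \<theta> \<le> w x})"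

text \<open>Otherwise \<open>Col t\<close> would contain all inserted items of weight at least
  \<open>w x\<close>, whereas \<open>Mk t\<close> misses \<open>x\<close>; domination would fail at
  the level \<open>w x\<close>.\<close>

lemma unmarked_le_uncollected:
  assumes "marks_dominate t" "x \<in> Ins t" "x \<notin> Mk t"
  obtains y where "y \<in> Ins t" "y \<notin> Col t" "w x \<le> w y"
proof (rule ccontr)
  assume "\<not> thesis"
  then have sub: "{y\<in>Ins t. w x \<le> w y} \<subseteq> {y\<in>Col t. w x \<le> w y}" using that by blast
  have fin: "finite (Ins t)" by (rule finite_Ins)
  have "card {y\<in>Mk t. w x \<le> w y} < card {y\<in>Ins t. w x \<le> w y}"
    using assms fin unfolding marks_dominate_def by (intro psubset_card_mono) auto
  also have "\<dots> \<le> card {y\<in>Col t. w x \<le> w y}"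
    using sub assms fin finite_subset unfolding marks_dominate_def
    by (intro card_mono) (auto intro: finite_subset)
  also have "\<dots> \<le> card {y\<in>Mk t. w x \<le> w y}"
    using assms unfolding marks_dominate_def by blast
  finally show False by simp
qed

lemma busy_step_candidate:
  assumes "marks_dominate t" "\<not> idle t"
  shows "h t \<in> Ins t - Mk t" "\<forall>x\<in>Ins t - Mk t. w x \<le> w (h t)"
    and "\<exists>y\<in>Act t - Col t. w (h t) / golden_ratio \<le> w y"
proof -
  obtain p where p: "p \<in> Act t" "p \<notin> Col t" using assms(2) by blast
  have "p \<in> Ins t" using p(1) Act_subset_Ins by blast
  then have "Col t \<subset> Ins t"
    using p(2) assms(1) unfolding marks_dominate_def by auto
  then have "card (Col t) < card (Ins t)" using finite_Ins by (rule psubset_card_mono[rotated])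
  then have "Mk t \<noteq> Ins t" using assms(1) unfolding marks_dominate_def by auto
  then have "Ins t - Mk t \<noteq> {}" using assms(1) unfolding marks_dominate_def by auto
  then show h: "h t \<in> Ins t - Mk t" "\<forall>x\<in>Ins t - Mk t. w x \<le> w (h t)"
    using mark_heaviest assms(2) by blast+
  obtain y where y: "y \<in> Ins t" "y \<notin> Col t" "w (h t) \<le> w y"
    using unmarked_le_uncollected[OF assms(1)] h by blast
  have le: "w (h t) / golden_ratio \<le> w (h t)"
    using golden_ratio_gt_1 w_nonneg[of "h t"] by (simp add: divide_le_eq mult_le_cancel_left1)
  show "\<exists>y\<in>Act t - Col t. w (h t) / golden_ratio \<le> w y"
  proof (cases "y \<in> Act t")
    case True
    then show ?thesis using y le by (intro bexI[of _ y]) auto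
  next
    case False
    \<comment> \<open>As \<open>y\<close> is deleted, it precedes the pending item \<open>p\<close>.
      Here the weights must be sorted across the deleted items as well.\<close>
    then have "w y \<le> w p"
      using deleted_before[OF y(1) False p(1)] w_mono y(1) p(1) Act_subset_Ins by blast
    then show ?thesis using p y le by (intro bexI[of _ p]) auto
  qed
qed

text \<open>Marking is greedy. At levels up to \<open>w (h t)\<close> the marks gain one item and
  the collection at most one; above, all items inserted so far are already marked.\<close>

lemma marks_dominate: "marks_dominate t"
proof (induction t)
  case 0
  then show ?case by (simp add: marks_dominate_def Mk_0 Col_0)
next
  case (Suc t)
  have mono: "Ins t \<subseteq> Ins (Suc t)" by (rule Ins_mono) simp
  show ?case
  proof (cases "idle t")
    case True
    then show ?thesis using Suc mono idle_step[OF True] unfolding marks_dominate_def by auto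
  next
    case False
    note h = busy_step_candidate[OF Suc False]
    note c = pick_earliest[OF False h(3)]
    have fin: "finite (Mk t)" "finite (Col t)"
      using Suc finite_Ins finite_subset unfolding marks_dominate_def by blast+
    have Mk: "Mk (Suc t) = insert (h t) (Mk t)" using Mk_Suc False by blast
    have "card {x\<in>Col (Suc t). \<theta> \<le> w x} \<le> card {x\<in>Mk (Suc t). \<theta> \<le> w x}" for \<theta>
    proof (cases "\<theta> \<le> w (h t)")
      case True
      have "{x\<in>Mk (Suc t). \<theta> \<le> w x} = insert (h t) {x\<in>Mk t. \<theta> \<le> w x}" using Mk True by auto
      then have "card {x\<in>Mk (Suc t). \<theta> \<le> w x} = Suc (card {x\<in>Mk t. \<theta> \<le> w x})"
        using h(1) fin by simp
      moreover have "card {x\<in>Col (Suc t). \<theta> \<le> w x} \<le> card (insert (c t) {x\<in>Col t. \<theta> \<le> w x})"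
        using c fin by (intro card_mono) auto
      moreover have "\<dots> \<le> Suc (card {x\<in>Col t. \<theta> \<le> w x})" by (rule card_insert_le_m1) simp_all
      ultimately show ?thesis using Suc unfolding marks_dominate_def by (metis (no_types, lifting) Suc_le_mono le_trans)
    next
      case False
      then have "x \<in> Mk t" if "x \<in> Ins t" "\<theta> \<le> w x" for x using h(2) that by force
      moreover have "Col (Suc t) \<subseteq> Ins t"
        using c Suc Act_subset_Ins unfolding marks_dominate_def by auto
      ultimately show ?thesis using Mk fin by (intro card_mono) auto
    qed
    moreover have "card (Col (Suc t)) = card (Mk (Suc t))"
      using c h(1) Mk fin Suc unfolding marks_dominate_def by simp
    moreover have "Mk (Suc t) \<subseteq> Ins (Suc t)" "Col (Suc t) \<subseteq> Ins (Suc t)"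
      using c h(1) Mk mono Suc Act_subset_Ins[of t] unfolding marks_dominate_def by auto
    ultimately show ?thesis unfolding marks_dominate_def by blast
  qed
qed

lemma Mk_subset: "Mk t \<subseteq> Ins t" and Col_subset: "Col t \<subseteq> Ins t"
  using marks_dominate unfolding marks_dominate_def by blast+

lemma finite_Act: "finite (Act t)"
  by (rule finite_subset[OF Act_subset_Ins finite_Ins])

text \<open>The invariant makes the conditional assumptions on \<open>h\<close> and \<open>c\<close>
  hold in every busy step; the threshold is restated without division.\<close>

lemma busy_step:
  assumes "\<not> idle t"
  shows h_unmarked: "h t \<in> Ins t" "h t \<notin> Mk t"
    and h_max: "x \<in> Ins t \<Longrightarrow> x \<notin> Mk t \<Longrightarrow> w x \<le> w (h t)"
    and c_pending: "c t \<in> Act t" "c t \<notin> Col t"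
    and c_threshold: "w (h t) \<le> golden_ratio * w (c t)"
    and c_earliest: "y \<in> Act t \<Longrightarrow> w (h t) \<le> golden_ratio * w y \<Longrightarrow> pos y < pos (c t) \<Longrightarrow> y \<in> Col t"
    and Col_Suc: "Col (Suc t) = insert (c t) (Col t)"
proof -
  note h = busy_step_candidate[OF marks_dominate assms]
  note c = pick_earliest[OF assms h(3)]
  show "h t \<in> Ins t" "h t \<notin> Mk t" "x \<in> Ins t \<Longrightarrow> x \<notin> Mk t \<Longrightarrow> w x \<le> w (h t)"
    "c t \<in> Act t" "c t \<notin> Col t" "Col (Suc t) = insert (c t) (Col t)" using h c by auto
  have eq: "w (h t) / golden_ratio \<le> r \<longleftrightarrow> w (h t) \<le> golden_ratio * r" for r
    using golden_ratio_gt_1 by (simp add: divide_le_eq mult.commute)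
  show "w (h t) \<le> golden_ratio * w (c t)" using c unfolding eq by blast
  show "y \<in> Act t \<Longrightarrow> w (h t) \<le> golden_ratio * w y \<Longrightarrow> pos y < pos (c t) \<Longrightarrow> y \<in> Col t"
    using c unfolding eq by force
qed

lemma Mk_mono: "s \<le> t \<Longrightarrow> Mk s \<subseteq> Mk t"
  using lift_Suc_mono_le[of Mk s t] idle_step Mk_Suc by blast

lemma Col_mono: "s \<le> t \<Longrightarrow> Col s \<subseteq> Col t"
  using lift_Suc_mono_le[of Col s t] idle_step Col_Suc by blast

lemma h_inj: "inj_on h {s. \<not> idle s}"
proof -
  have "h s \<noteq> h t" if "s < t" "\<not> idle s" "\<not> idle t" for s t
    using Mk_Suc[OF that(2)] Mk_mono[of "Suc s" t] h_unmarked[OF that(3)] that(1) by (metis Suc_leI insertI1 subsetD)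
  then show ?thesis by (intro inj_onI) (metis linorder_neqE_nat mem_Collect_eq)
qed

lemma c_inj: "inj_on c {s. \<not> idle s}"
proof -
  have "c s \<noteq> c t" if "s < t" "\<not> idle s" "\<not> idle t" for s t
    using Col_Suc[OF that(2)] Col_mono[of "Suc s" t] c_pending[OF that(3)] that(1) by (metis Suc_leI insertI1 subsetD)
  then show ?thesis by (intro inj_onI) (metis linorder_neqE_nat mem_Collect_eq)
qed

lemma Col_eq: "a \<le> t \<Longrightarrow> Col t = Col a \<union> c ` {s\<in>{a..<t}. \<not> idle s}"
proof (induction rule: dec_induct)
  case (step t)
  have "{s\<in>{a..<Suc t}. \<not> idle s} = (if idle t then {} else {t}) \<union> {s\<in>{a..<t}. \<not> idle s}"
    using step.hyps by (auto simp: less_Suc_eq)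
  then show ?case using step idle_step[of t] Col_Suc[of t] by (cases "idle t") auto
qed auto

lemma Act_between:
  assumes "x \<in> Ins s" "s \<le> t" "t \<le> t'" "x \<in> Act t'"
  shows "x \<in> Act t"
  using deleted[of x t t'] Ins_mono[of s t] assms by blast

end

section \<open>Comparison with another schedule\<close>

text \<open>\<open>ad\<close> is the competing schedule, as a function on all steps, and
  \<open>n\<close> is the number of steps that count.\<close>

locale schedule_against_run = mark_and_pick_run w pos Ins Act Mk Col h c
  for w :: "'a \<Rightarrow> real" and pos Ins Act Mk Col h c +
  fixes n :: nat and ad :: "nat \<Rightarrow> 'a option"
  assumes ad_active: "ad t = Some x \<Longrightarrow> x \<in> Act t"
    and ad_once: "ad t = Some x \<Longrightarrow> ad s = Some x \<Longrightarrow> s = t"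
begin

definition taken :: "nat \<Rightarrow> 'a set" where
  "taken t = {x. \<exists>s<t. ad s = Some x}"

definition retained :: "'a set" where
  "retained = {x. \<exists>t<n. idle t \<and> x \<in> Act t}"

definition credit :: "nat \<Rightarrow> real" where
  "credit s = (if c s \<in> retained then w (c s) / golden_ratio else w (h s))"

lemma taken_Suc: "taken (Suc t) = set_option (ad t) \<union> taken t"
  unfolding taken_def by (auto simp: less_Suc_eq)

lemma taken_subset: "t \<le> Suc s \<Longrightarrow> taken t \<subseteq> Ins s"
proof
  fix x assume "t \<le> Suc s" "x \<in> taken t"
  then obtain r where "r < t" "ad r = Some x" unfolding taken_def by blast
  then have "r \<le> s" "ad r = Some x" using \<open>t \<le> Suc s\<close> by auto
  then show "x \<in> Ins s" using ad_active Act_subset_Ins[of r] Ins_mono[of r s] by blast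
qed

lemma finite_taken: "finite (taken t)"
  using finite_subset[OF taken_subset[of t t] finite_Ins] by simp

lemma retained_collected: "retained \<subseteq> Col n"
  unfolding retained_def using Col_mono[OF less_imp_le] by blast

end

section \<open>Counting at one threshold within one busy phase\<close>

text \<open>A maximal interval \<open>{a..<b}\<close> of non-idle steps.\<close>

locale busy_phase = schedule_against_run w pos Ins Act Mk Col h c n ad
  for w :: "'a \<Rightarrow> real" and pos Ins Act Mk Col h c n ad +
  fixes \<theta> :: real and a b :: nat
  assumes \<theta>_pos: "\<theta> > 0"
    and ab: "a \<le> b"
    and busy: "a \<le> s \<Longrightarrow> s < b \<Longrightarrow> \<not> idle s"
    and start: "a = 0 \<or> (\<exists>i<n. a = Suc i \<and> idle i)"
    and stop: "b = n \<or> b < n \<and> idle b"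
begin

definition big :: "'a set" where
  "big = {x. x \<notin> retained \<and> \<theta> \<le> w x}"

abbreviation "got t \<equiv> taken t \<inter> big"
abbreviation "alive t \<equiv> Act t \<inter> big"
abbreviation "unmarked t \<equiv> (Ins t - Mk t) \<inter> big"

lemma fin [simp]: "finite (got t)" "finite (alive t)" "finite (unmarked t)"
  using finite_taken finite_Act finite_Ins by auto

lemma golden_\<theta>: "\<theta> < golden_ratio * \<theta>"
  using golden_ratio_gt_1 \<theta>_pos by simp

text \<open>A relevant item is not retained, hence not active in the idle step just before
  \<open>a\<close>. Since deletion is final, it can only have been inserted after that step, so a
  phase inherits no marks or collections of relevant active items.\<close>

lemma start_fresh:
  assumes "x \<in> alive a"
  shows "x \<notin> Mk a" "x \<notin> Col a"
proof -
  have "x \<notin> Mk a \<and> x \<notin> Col a"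
    using start
  proof
    assume "\<exists>i<n. a = Suc i \<and> idle i"
    then obtain i where i: "i < n" "a = Suc i" "idle i" by blast
    have "x \<notin> Act i" using assms i unfolding big_def retained_def by auto
    then have "x \<notin> Ins i" using deleted[of x i a] assms i by auto
    then show ?thesis using idle_step[OF i(3)] i(2) Mk_subset Col_subset by blast
  qed (simp add: Mk_0 Col_0)
  then show "x \<notin> Mk a" "x \<notin> Col a" by auto
qed

text \<open>\<open>c s\<close> is uncollected at step \<open>s\<close>, so an idle step in which it
  is active comes later, hence not before \<open>b\<close>; until then it cannot have been
  deleted.\<close>

lemma retained_active_at_stop:
  assumes "a \<le> s" "s < b" "c s \<in> retained"
  shows "b < n" "idle b" "c s \<in> Act b"
proof -
  obtain t where t: "t < n" "idle t" "c s \<in> Act t" using assms(3) unfolding retained_def by blast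
  note s = c_pending[OF busy[OF assms(1,2)]]
  have "\<not> t \<le> s" using s(2) t Col_mono[of t s] by blast
  then have "b \<le> t" using busy[of t] assms t(2) by (meson le_cases le_trans not_le)
  then show "b < n" using t(1) by simp
  then show "idle b" using stop by auto
  show "c s \<in> Act b"
    using Act_between[OF _ _ \<open>b \<le> t\<close> t(3), of s] s(1) Act_subset_Ins[of s] assms(2) by auto
qed

lemma got_Suc_subset: "got (Suc t) \<subseteq> got t \<union> alive t"
  using ad_active unfolding taken_Suc by (cases "ad t") auto

lemma card_got_Suc: "card (got (Suc t)) \<le> card (got t \<union> alive t)"
  by (intro card_mono got_Suc_subset) auto

lemma card_got_Suc_le: "card (got (Suc t)) \<le> Suc (card (got t))"
proof (cases "ad t")
  case None
  then show ?thesis by (simp add: taken_Suc)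
next
  case (Some x)
  have "card (got (Suc t)) \<le> card (insert x (got t))"
    by (intro card_mono) (auto simp: taken_Suc Some)
  then show ?thesis by (auto simp: card_insert_if split: if_splits)
qed

text \<open>\<open>got t \<union> alive t\<close> is what the other schedule has or can take at
  once. It grows only by new items, which are all unmarked. Its excess over the number of unmarked
  items therefore rises only when a mark removes an item from \<open>unmarked t\<close>, which
  requires \<open>\<theta> \<le> w (h t)\<close>.\<close>

lemma reach_Suc:
  assumes "a \<le> t" "t < b"
  shows "card (got (Suc t) \<union> alive (Suc t)) \<le> card (got t \<union> alive t) + card (unmarked (Suc t))"
    and "card (got (Suc t) \<union> alive (Suc t)) + card (unmarked t)
      \<le> card (got t \<union> alive t) + card (unmarked (Suc t)) + (if \<theta> \<le> w (h t) then 1 else 0)"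
proof -
  let ?new = "(Ins (Suc t) - Ins t) \<inter> big"
  have nb: "\<not> idle t" using busy assms by blast
  have mono: "Ins t \<subseteq> Ins (Suc t)" by (rule Ins_mono) simp
  have fn: "finite ?new" using finite_Ins by auto
  have "Act (Suc t) \<inter> Ins t \<subseteq> Act t" using deleted[of _ t "Suc t"] by auto
  then have sub: "got (Suc t) \<union> alive (Suc t) \<subseteq> (got t \<union> alive t) \<union> ?new"
    using got_Suc_subset[of t] Act_subset_Ins[of "Suc t"] by auto
  have le: "card (got (Suc t) \<union> alive (Suc t)) \<le> card (got t \<union> alive t) + card ?new"
    by (rule order_trans[OF card_mono[OF _ sub] card_Un_le]) (use fn in auto)
  have Mk: "Mk (Suc t) = insert (h t) (Mk t)" using Mk_Suc[OF nb] .
  have newsub: "?new \<subseteq> unmarked (Suc t)"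
    using Mk Mk_subset[of t] h_unmarked[OF nb] by auto
  then have "card ?new \<le> card (unmarked (Suc t))" by (intro card_mono) auto
  then show "card (got (Suc t) \<union> alive (Suc t)) \<le> card (got t \<union> alive t) + card (unmarked (Suc t))"
    using le by linarith
  have disj: "(unmarked t - {h t}) \<inter> ?new = {}" by auto
  have "(unmarked t - {h t}) \<union> ?new \<subseteq> unmarked (Suc t)"
    using newsub Mk mono by auto
  then have "card ((unmarked t - {h t}) \<union> ?new) \<le> card (unmarked (Suc t))" by (intro card_mono) auto
  then have "card (unmarked t - {h t}) + card ?new \<le> card (unmarked (Suc t))"
    using card_Un_disjoint[OF _ fn disj] by simp
  moreover have "card (unmarked t) \<le> card (unmarked t - {h t}) + (if \<theta> \<le> w (h t) then 1 else 0)"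
  proof (cases "\<theta> \<le> w (h t)")
    case True
    then show ?thesis using diff_card_le_card_Diff[of "{h t}" "unmarked t"] by auto
  next
    case False
    then have "h t \<notin> unmarked t" by (simp add: big_def)
    then show ?thesis by simp
  qed
  ultimately show "card (got (Suc t) \<union> alive (Suc t)) + card (unmarked t)
      \<le> card (got t \<union> alive t) + card (unmarked (Suc t)) + (if \<theta> \<le> w (h t) then 1 else 0)"
    using le by linarith
qed

lemma reach_start: "card (got a \<union> alive a) \<le> card (got a) + card (unmarked a)"
proof -
  have "alive a \<subseteq> unmarked a" using start_fresh Act_subset_Ins by auto
  then have "card (alive a) \<le> card (unmarked a)" by (intro card_mono) auto
  then show ?thesis using card_Un_le[of "got a" "alive a"] by linarith
qed

lemma unmarked_empty:
  assumes "a \<le> t" "t < b" "w (h t) < \<theta>"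
  shows "unmarked t = {}"
  using h_max[OF busy[OF assms(1,2)]] assms(3) unfolding big_def by force

lemma card_range_Suc:
  assumes "a \<le> t"
  shows "card {s\<in>{a..<Suc t}. P s} = card {s\<in>{a..<t}. P s} + (if P t then 1 else 0)"
proof -
  have "{s\<in>{a..<Suc t}. P s} = (if P t then {t} else {}) \<union> {s\<in>{a..<t}. P s}"
    using assms by (auto simp: less_Suc_eq)
  then show ?thesis by simp
qed

text \<open>Here every collection of a retained item earns a credit, so the first invariant,
  on marked items, suffices.\<close>

lemma phase_heavy:
  assumes "\<And>s. a \<le> s \<Longrightarrow> s < b \<Longrightarrow> c s \<in> retained \<Longrightarrow> golden_ratio * \<theta> \<le> w (c s)"
  shows "card (got b) \<le> card (got a) + card {s\<in>{a..<b}. \<theta> \<le> credit s}"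
proof -
  define g where "g t = card (got a) + card {s\<in>{a..<t}. \<theta> \<le> credit s}" for t
  have "t \<le> b \<Longrightarrow> card (got t \<union> alive t) \<le> g t + card (unmarked t) \<and> card (got t) \<le> g t" if "a \<le> t" for t
    using that
  proof (induction rule: dec_induct)
    case base
    then show ?case using reach_start by (simp add: g_def)
  next
    case (step t)
    then have t: "a \<le> t" "t < b" by auto
    have IH: "card (got t \<union> alive t) \<le> g t + card (unmarked t)" "card (got t) \<le> g t"
      using step by auto
    have g: "g (Suc t) = g t + (if \<theta> \<le> credit t then 1 else 0)"
      unfolding g_def using card_range_Suc[OF t(1)] by simp
    show ?case
    proof (cases "\<theta> \<le> credit t")
      case True
      then show ?thesis using g IH reach_Suc(2)[OF t] card_got_Suc_le[of t] by (auto split: if_splits)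
    next
      case False
      \<comment> \<open>Without a credit, \<open>w (h t) < \<theta>\<close>, so
        \<open>unmarked t\<close> is empty and the invariant says that everything within reach is
        already paid for.\<close>
      have "c t \<notin> retained"
        using assms[OF t] False golden_ratio_gt_1 unfolding credit_def
        by (auto simp: field_simps split: if_splits)
      then have "w (h t) < \<theta>" using False by (simp add: credit_def)
      then show ?thesis
        using g IH reach_Suc[OF t] card_got_Suc[of t] unmarked_empty[OF t] False by auto
    qed
  qed
  from this[OF ab] show ?thesis by (simp add: g_def)
qed

text \<open>A suffix, in queue order, of the relevant active items.\<close>

definition upclosed :: "nat \<Rightarrow> 'a set \<Rightarrow> bool" where
  "upclosed t V \<longleftrightarrow> V \<subseteq> alive t \<and> (\<forall>x\<in>V. \<forall>y\<in>alive t. pos x \<le> pos y \<longrightarrow> y \<in> V)"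

text \<open>If all items within reach are paid for, so are the untaken items of \<open>V\<close>
  together with \<open>got (Suc t)\<close>. The estimate holds for any \<open>A\<close>, since at
  worst \<open>A\<close> contains all of \<open>V\<close>.\<close>

lemma settled_step:
  assumes "card (got t \<union> alive t) \<le> k" "V \<subseteq> alive t"
  shows "card (got (Suc t)) + card (V \<inter> A) \<le> k + card (V \<inter> taken (Suc t))"
proof -
  have fV: "finite V" by (rule finite_subset[OF assms(2) fin(2)])
  have "card (got (Suc t)) + card (V - taken (Suc t)) = card (got (Suc t) \<union> (V - taken (Suc t)))"
    by (intro card_Un_disjoint[symmetric]) (use fV in auto)
  also have "\<dots> \<le> card (got t \<union> alive t)"
    using got_Suc_subset[of t] assms(2) by (intro card_mono) auto
  finally have "card (got (Suc t)) + card (V - taken (Suc t)) \<le> k" using assms(1) by linarith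
  moreover have "card (V \<inter> A) \<le> card V" using fV by (intro card_mono) auto
  moreover have "card V = card (V \<inter> taken (Suc t)) + card (V - taken (Suc t))"
    using card_Int_Diff[OF fV] .
  ultimately show ?thesis by linarith
qed

lemma upclosed_alive: "upclosed t (alive t)"
  unfolding upclosed_def by blast

text \<open>Items of \<open>V\<close> inserted after step \<open>t\<close> are neither collected nor
  taken yet, so \<open>V\<close> may be cut down to \<open>Ins t\<close>. The result is a suffix at
  step \<open>t\<close>: an item behind one that survives the deletions survives them too.\<close>

lemma upclosed_Suc:
  assumes t: "a \<le> t" "t < b"
    and bound: "\<And>V. upclosed t V \<Longrightarrow>
      card (got (Suc t)) + card (V \<inter> Col (Suc t)) \<le> k + card (V \<inter> taken (Suc t))"
    and V: "upclosed (Suc t) V"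
  shows "card (got (Suc t)) + card (V \<inter> Col (Suc t)) \<le> k + card (V \<inter> taken (Suc t))"
proof -
  have "Col (Suc t) \<subseteq> Ins t"
    using Col_Suc[OF busy[OF t]] Col_subset[of t] c_pending[OF busy[OF t]] Act_subset_Ins[of t] by auto
  moreover have "taken (Suc t) \<subseteq> Ins t" by (rule taken_subset) simp
  ultimately have eq: "V \<inter> Ins t \<inter> Col (Suc t) = V \<inter> Col (Suc t)"
    "V \<inter> Ins t \<inter> taken (Suc t) = V \<inter> taken (Suc t)" by auto
  have "upclosed t (V \<inter> Ins t)"
    unfolding upclosed_def
  proof (intro conjI ballI impI)
    have "V \<subseteq> alive (Suc t)" using V unfolding upclosed_def by blast
    then show "V \<inter> Ins t \<subseteq> alive t" using deleted[of _ t "Suc t"] by auto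
    fix x y assume x: "x \<in> V \<inter> Ins t" and y: "y \<in> alive t" and le: "pos x \<le> pos y"
    have "x \<in> Act (Suc t)" using x V unfolding upclosed_def by blast
    moreover have "y \<in> Ins (Suc t)" using y Act_subset_Ins[of t] Ins_mono[of t "Suc t"] by auto
    ultimately have "y \<in> Act (Suc t)" using deleted_before[of y "Suc t" x] le by fastforce
    then have "y \<in> V" using V x y le unfolding upclosed_def by blast
    then show "y \<in> V \<inter> Ins t" using y Act_subset_Ins[of t] by blast
  qed
  from bound[OF this] show ?thesis unfolding eq .
qed

text \<open>At the idle step \<open>b\<close> the item \<open>c t\<close> is still active, but
  \<open>y\<close>, not being retained, is deleted; deletions remove prefixes.\<close>

lemma alive_before_retained:
  assumes t: "a \<le> t" "t < b" and ret: "c t \<in> retained" and y: "y \<in> alive t"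
  shows "pos y < pos (c t)"
proof -
  note b = retained_active_at_stop[OF t ret]
  have "y \<notin> Act b" using y b unfolding big_def retained_def by blast
  moreover have "y \<in> Ins b" using y Act_subset_Ins[of t] Ins_mono[of t b] t by auto
  ultimately show ?thesis using deleted_before b(3) by blast
qed

text \<open>\<open>y\<close> meets the threshold of step \<open>t\<close>, so it would have been
  picked in place of \<open>c t\<close> if it were pending.\<close>

lemma alive_collected:
  assumes t: "a \<le> t" "t < b" and h: "w (h t) < golden_ratio * \<theta>"
    and y: "y \<in> alive t" "pos y < pos (c t)"
  shows "y \<in> Col t"
proof (rule c_earliest[OF busy[OF t]])
  have "golden_ratio * \<theta> \<le> golden_ratio * w y"
    using y golden_ratio_gt_1 unfolding big_def by auto
  then show "w (h t) \<le> golden_ratio * w y" using h by linarith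
qed (use y in auto)

lemma card_Int_Col_Suc:
  assumes "a \<le> t" "t < b" "V \<subseteq> alive t"
  shows "card (V \<inter> Col (Suc t)) \<le> card (V \<inter> Col t) + (if c t \<in> V then 1 else 0)"
proof -
  have "finite V" by (rule finite_subset[OF assms(3) fin(2)])
  moreover have "V \<inter> Col (Suc t) = (if c t \<in> V then insert (c t) (V \<inter> Col t) else V \<inter> Col t)"
    using Col_Suc[OF busy[OF assms(1,2)]] by auto
  ultimately show ?thesis by (auto simp: card_insert_if)
qed

text \<open>If the other schedule takes an item \<open>x\<close> outside of the suffix \<open>V\<close>, then the items outside of
  \<open>V\<close>, among them \<open>x\<close>, have already been collected, so the invariant for the suffix of all
  relevant active items is stronger by one than that for \<open>V\<close>.\<close>

lemma in_order_step:
  assumes t: "a \<le> t" "t < b" and h: "w (h t) < golden_ratio * \<theta>"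
    and IH: "\<And>V. upclosed t V \<Longrightarrow> card (got t) + card (V \<inter> Col t) \<le> g + card (V \<inter> taken t)"
    and V: "upclosed t V"
  shows "card (got (Suc t)) + card (V \<inter> Col (Suc t)) \<le> g + 1 + card (V \<inter> taken (Suc t))"
proof -
  have Vsub: "V \<subseteq> alive t" using V unfolding upclosed_def by blast
  have fV: "finite V" by (rule finite_subset[OF Vsub fin(2)])
  have mono: "card (V \<inter> taken t) \<le> card (V \<inter> taken (Suc t))"
    using fV by (intro card_mono) (auto simp: taken_Suc)
  note C = card_Int_Col_Suc[OF t Vsub]
  show ?thesis
  proof (cases "c t \<in> V \<and> (\<exists>x. ad t = Some x \<and> x \<in> big)")
    case False
    then have "c t \<notin> V \<or> got (Suc t) = got t" by (cases "ad t") (auto simp: taken_Suc)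
    then show ?thesis using C mono IH[OF V] card_got_Suc_le[of t] by (auto split: if_splits)
  next
    case True
    then obtain x where x: "ad t = Some x" "x \<in> alive t" and cV: "c t \<in> V" using ad_active by blast
    have xt: "x \<notin> taken t" using ad_once[OF x(1)] unfolding taken_def by fastforce
    show ?thesis
    proof (cases "x \<in> V")
      case True
      \<comment> \<open>Both \<open>got\<close> and the collected part of \<open>V\<close> may grow,
        but \<open>x\<close> also enlarges the right side, so one credit is enough.\<close>
      have "V \<inter> taken (Suc t) = insert x (V \<inter> taken t)" using x True by (auto simp: taken_Suc)
      then have "card (V \<inter> taken (Suc t)) = Suc (card (V \<inter> taken t))" using fV xt by simp
      then show ?thesis using C cV IH[OF V] card_got_Suc_le[of t] by auto
    next
      case False
      let ?E = "alive t - V"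
      have fE: "finite ?E" using fin(2) by auto
      have E: "?E \<subseteq> Col t"
      proof
        fix y assume y: "y \<in> ?E"
        then have "pos y < pos (c t)" using V cV unfolding upclosed_def by (meson DiffD1 DiffD2 not_le)
        then show "y \<in> Col t" using alive_collected[OF t h, of y] y by blast
      qed
      have "alive t \<inter> Col t = (V \<inter> Col t) \<union> ?E" using E Vsub by blast
      moreover have "card ((V \<inter> Col t) \<union> ?E) = card (V \<inter> Col t) + card ?E"
        using fV fE by (intro card_Un_disjoint) auto
      ultimately have "card (alive t \<inter> Col t) = card (V \<inter> Col t) + card ?E" by simp
      moreover have "card (alive t \<inter> taken t) \<le> card (V \<inter> taken t) + card (?E \<inter> taken t)"
      proof -
        have "alive t \<inter> taken t = (V \<inter> taken t) \<union> (?E \<inter> taken t)" using Vsub by blast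
        then show ?thesis by (metis card_Un_le)
      qed
      moreover have "card (?E \<inter> taken t) < card ?E"
        using fE x False xt by (intro psubset_card_mono) auto
      ultimately have "card (got t) + card (V \<inter> Col t) + 1 \<le> g + card (V \<inter> taken t)"
        using IH[OF upclosed_alive] by linarith
      then show ?thesis using C cV mono card_got_Suc_le[of t] by auto
    qed
  qed
qed

text \<open>The light item \<open>c s0\<close> is active at \<open>b\<close>, so all items deleted
  by then are lighter than \<open>\<phi> * \<theta>\<close>. Thus \<open>h s\<close> is active at
  the idle step \<open>b\<close>, hence retained and collected. Had it been collected before
  \<open>a\<close>, then, being unmarked, it would force an uncollected item at least as heavy at
  the preceding idle step; that item would be deleted yet heavy.\<close>

lemma heavy_mark_retained:
  assumes s0: "a \<le> s0" "s0 < b" "c s0 \<in> retained" "w (c s0) < golden_ratio * \<theta>"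
    and s: "a \<le> s" "s < b" "golden_ratio * \<theta> \<le> w (h s)"
  shows "h s \<in> c ` {r\<in>{a..<b}. c r \<in> retained \<and> golden_ratio * \<theta> \<le> w (c r)}"
proof -
  note b = retained_active_at_stop[OF s0(1-3)]
  note hs = h_unmarked[OF busy[OF s(1,2)]]
  have light: "w y < golden_ratio * \<theta>" if "y \<in> Ins b" "y \<notin> Act b" for y
  proof -
    have "w y \<le> w (c s0)"
      using w_mono[of y b "c s0"] deleted_before[OF that b(3)] that b(3) Act_subset_Ins[of b] by blast
    then show ?thesis using s0(4) by linarith
  qed
  have "h s \<in> Ins b" using hs(1) Ins_mono[of s b] s(2) by auto
  then have act: "h s \<in> Act b" using light s(3) by force
  have ret: "h s \<in> retained" using act b unfolding retained_def by blast
  have "h s \<notin> Col a"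
  proof
    assume col: "h s \<in> Col a"
    then obtain i where i: "a = Suc i" "idle i" using start Col_0 by auto
    have "h s \<in> Ins i" "h s \<notin> Mk i"
      using col idle_step[OF i(2)] Col_subset[of i] i(1) hs(2) Mk_mono[of i s] s(1) by auto
    then obtain y where y: "y \<in> Ins i" "y \<notin> Col i" "w (h s) \<le> w y"
      using unmarked_le_uncollected[OF marks_dominate] by blast
    have "y \<notin> Act i" using y(2) i(2) by blast
    then have "y \<notin> Act b" "y \<in> Ins b" using y(1) deleted[of y i b] Ins_mono[of i b] i(1) ab by auto
    then show False using light y(3) s(3) by force
  qed
  then have "h s \<in> c ` {r\<in>{a..<b}. \<not> idle r}" using act b(2) Col_eq[OF ab] by blast
  then show ?thesis using ret s(3) by auto
qed

text \<open>In this case a mark of weight at least \<open>\<phi> * \<theta>\<close> is put on a retained item that is collected in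
  the same phase, and the credit of this item is spent already when it is marked. Hence a step
  may spend two credits, which pays for a collection out of queue order.\<close>

lemma phase_light:
  assumes s0: "a \<le> s0" "s0 < b" "c s0 \<in> retained" "w (c s0) < golden_ratio * \<theta>"
  shows "card (got b) \<le> card (got a) + card {s\<in>{a..<b}. \<theta> \<le> credit s}"
proof -
  \<comment> \<open>\<open>lost\<close> counts credits from picks that are not retained,
    \<open>heavy\<close> counts prepaid credits of retained picks. Hence \<open>g\<close> may run
    ahead of the credits earned so far and is compared with them only at \<open>b\<close>.\<close>
  define lost where "lost t = card {s\<in>{a..<t}. c s \<notin> retained \<and> \<theta> \<le> w (h s)}" for t
  define heavy where "heavy t = card {s\<in>{a..<t}. golden_ratio * \<theta> \<le> w (h s)}" for t
  define g where "g t = card (got a) + lost t + heavy t" for t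
  have "t \<le> b \<Longrightarrow> card (got t \<union> alive t) \<le> g t + card (unmarked t) \<and>
      (\<forall>V. upclosed t V \<longrightarrow> card (got t) + card (V \<inter> Col t) \<le> g t + card (V \<inter> taken t))"
    if "a \<le> t" for t
    using that
  proof (induction rule: dec_induct)
    case base
    have "V \<inter> Col a = {}" if "upclosed a V" for V
      using that start_fresh unfolding upclosed_def by blast
    then show ?case using reach_start by (simp add: g_def lost_def heavy_def)
  next
    case (step t)
    then have t: "a \<le> t" "t < b" by auto
    have IH1: "card (got t \<union> alive t) \<le> g t + card (unmarked t)"
      and IH2: "\<And>V. upclosed t V \<Longrightarrow> card (got t) + card (V \<inter> Col t) \<le> g t + card (V \<inter> taken t)"
      using step by auto
    have g: "g (Suc t) = g t + (if c t \<notin> retained \<and> \<theta> \<le> w (h t) then 1 else 0)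
        + (if golden_ratio * \<theta> \<le> w (h t) then 1 else 0)"
      unfolding g_def lost_def heavy_def using card_range_Suc[OF t(1)] by simp
    \<comment> \<open>No credit is spent although \<open>\<theta> \<le> w (h t)\<close>: then
      \<open>c t\<close> is retained and all relevant active items, lying before it, are collected.
      The suffix invariant for \<open>alive t\<close> bounds the reach.\<close>
    have settled: "card (got t \<union> alive t) \<le> g t"
      if "g (Suc t) = g t" "\<theta> \<le> w (h t)"
    proof -
      have light: "w (h t) < golden_ratio * \<theta>" and ret: "c t \<in> retained"
        using that g by (auto split: if_splits)
      have "alive t \<inter> Col t = alive t"
        using alive_collected[OF t light] alive_before_retained[OF t ret] by blast
      then have "card (got t) + card (alive t) \<le> g t + card (alive t \<inter> taken t)"
        using IH2[OF upclosed_alive] by simp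
      moreover have "card (alive t) = card (alive t \<inter> taken t) + card (alive t - taken t)"
        by (rule card_Int_Diff) simp
      moreover have "card (got t \<union> alive t) = card (got t) + card (alive t - taken t)"
      proof -
        have "got t \<union> alive t = got t \<union> (alive t - taken t)" by blast
        moreover have "card (got t \<union> (alive t - taken t)) = card (got t) + card (alive t - taken t)"
          by (rule card_Un_disjoint) auto
        ultimately show ?thesis by simp
      qed
      ultimately show ?thesis by linarith
    qed
    have "card (got (Suc t) \<union> alive (Suc t)) \<le> g (Suc t) + card (unmarked (Suc t))"
    proof (cases "g (Suc t) = g t \<and> \<theta> \<le> w (h t)")
      case True
      then show ?thesis using settled reach_Suc(1)[OF t] by linarith
    next
      case False
      then show ?thesis using g IH1 reach_Suc(2)[OF t] by (auto split: if_splits)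
    qed
    moreover have "card (got (Suc t)) + card (V \<inter> Col (Suc t)) \<le> g (Suc t) + card (V \<inter> taken (Suc t))"
      if V: "upclosed t V" for V
    proof -
      have Vsub: "V \<subseteq> alive t" using V unfolding upclosed_def by blast
      \<comment> \<open>In cases 1 and 2 everything within reach is paid for; in 3 picking follows
        the queue order; in 4 the pick is retained, hence outside of \<open>V\<close>; in 5 two
        credits pay for the growth of both \<open>got\<close> and the collected part of
        \<open>V\<close>.\<close>
      consider "w (h t) < \<theta>" | "\<theta> \<le> w (h t)" "g (Suc t) = g t"
        | "w (h t) < golden_ratio * \<theta>" "g (Suc t) = g t + 1"
        | "golden_ratio * \<theta> \<le> w (h t)" "c t \<in> retained" "g (Suc t) = g t + 1"
        | "g (Suc t) = g t + 2"
        by (cases "w (h t) < \<theta>") (use g golden_\<theta> in \<open>auto split: if_splits\<close>)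
      then show ?thesis
      proof cases
        case 1
        then have "card (got t \<union> alive t) \<le> g t" using IH1 unmarked_empty[OF t] by simp
        then have "card (got (Suc t)) + card (V \<inter> Col (Suc t)) \<le> g t + card (V \<inter> taken (Suc t))"
          using settled_step[OF _ Vsub] by blast
        then show ?thesis using g by linarith
      next
        case 2
        then show ?thesis using settled_step[OF settled Vsub] by simp
      next
        case 3
        then show ?thesis using in_order_step[OF t _ IH2 V] by simp
      next
        case 4
        have "finite V" by (rule finite_subset[OF Vsub fin(2)])
        then have "card (V \<inter> taken t) \<le> card (V \<inter> taken (Suc t))"
          by (intro card_mono) (auto simp: taken_Suc)
        moreover have "c t \<notin> V" using 4 Vsub unfolding big_def by blast
        ultimately show ?thesis
          using 4 card_Int_Col_Suc[OF t Vsub] IH2[OF V] card_got_Suc_le[of t] by auto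
      next
        case 5
        have "finite V" by (rule finite_subset[OF Vsub fin(2)])
        then have "card (V \<inter> taken t) \<le> card (V \<inter> taken (Suc t))"
          by (intro card_mono) (auto simp: taken_Suc)
        then show ?thesis
          using 5 card_Int_Col_Suc[OF t Vsub] IH2[OF V] card_got_Suc_le[of t] by (auto split: if_splits)
      qed
    qed
    ultimately show ?case using upclosed_Suc[OF t] by blast
  qed
  \<comment> \<open>The empty suffix gives the bound on \<open>got b\<close>.\<close>
  from this[OF ab] have "card (got b) \<le> g b"
    unfolding upclosed_def by (metis (no_types, lifting) Int_empty_left add.right_neutral card.empty
        empty_iff empty_subsetI le_refl)
  moreover have "heavy b \<le> card {s\<in>{a..<b}. c s \<in> retained \<and> golden_ratio * \<theta> \<le> w (c s)}" (is "_ \<le> card ?K")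
  proof -
    have "inj_on h {s\<in>{a..<b}. golden_ratio * \<theta> \<le> w (h s)}"
      using h_inj by (rule inj_on_subset) (use busy in auto)
    then have "heavy b = card (h ` {s\<in>{a..<b}. golden_ratio * \<theta> \<le> w (h s)})"
      unfolding heavy_def by (simp add: card_image)
    also have "\<dots> \<le> card (c ` ?K)"
      using heavy_mark_retained[OF s0] by (intro card_mono) auto
    also have "\<dots> \<le> card ?K" by (rule card_image_le) simp
    finally show ?thesis .
  qed
  moreover have "card {s\<in>{a..<b}. \<theta> \<le> credit s} = lost b + card ?K"
  proof -
    have "\<theta> \<le> r / golden_ratio \<longleftrightarrow> golden_ratio * \<theta> \<le> r" for r
      using golden_ratio_gt_1 by (simp add: field_simps)
    then have "{s\<in>{a..<b}. \<theta> \<le> credit s} = {s\<in>{a..<b}. c s \<notin> retained \<and> \<theta> \<le> w (h s)} \<union> ?K"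
      unfolding credit_def by auto
    moreover have "card ({s\<in>{a..<b}. c s \<notin> retained \<and> \<theta> \<le> w (h s)} \<union> ?K) = lost b + card ?K"
      unfolding lost_def by (rule card_Un_disjoint) auto
    ultimately show ?thesis by simp
  qed
  ultimately show ?thesis by (simp add: g_def)
qed

lemma phase_bound: "card (got b) \<le> card (got a) + card {s\<in>{a..<b}. \<theta> \<le> credit s}"
  using phase_heavy phase_light by (meson not_le)

end

section \<open>From phases and thresholds to total weight\<close>

context schedule_against_run
begin

text \<open>Induction over idle steps: split at the last idle step \<open>i\<close> before
  \<open>t\<close> and apply the phase bound from \<open>Suc i\<close> on. In step \<open>i\<close>
  itself the other schedule can only take a retained item, and no credit is counted.\<close>

lemma level_bound:
  assumes "\<theta> > 0" "t = n \<or> t < n \<and> idle t"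
  shows "card (taken t \<inter> {x. x \<notin> retained \<and> \<theta> \<le> w x})
    \<le> card {s\<in>{s. s < t \<and> \<not> idle s}. \<theta> \<le> credit s}"
  using assms(2)
proof (induction t rule: less_induct)
  case (less t)
  let ?B = "{x. x \<notin> retained \<and> \<theta> \<le> w x}"
  let ?G = "\<lambda>t. {s\<in>{s. s < t \<and> \<not> idle s}. \<theta> \<le> credit s}"
  obtain a where a: "a \<le> t" "\<And>s. a \<le> s \<Longrightarrow> s < t \<Longrightarrow> \<not> idle s"
    "a = 0 \<or> (\<exists>i<n. a = Suc i \<and> idle i)" "card (taken a \<inter> ?B) \<le> card (?G a)"
  proof (cases "\<exists>i<t. idle i")
    case False
    show thesis
    proof (rule that[of 0])
      show "card (taken 0 \<inter> ?B) \<le> card (?G 0)" by (simp add: taken_def)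
    qed (use False in auto)
  next
    case True
    define i where "i = Max {i. i < t \<and> idle i}"
    have "i \<in> {i. i < t \<and> idle i}" unfolding i_def using True by (intro Max_in) auto
    then have i: "i < t" "idle i" by auto
    have max: "\<not> idle s" if "Suc i \<le> s" "s < t" for s
    proof
      assume "idle s"
      then have "s \<le> i" unfolding i_def using that(2) by (intro Max_ge) auto
      then show False using that(1) by simp
    qed
    have "i < n" using i less.prems by auto
    have "taken (Suc i) \<inter> ?B = taken i \<inter> ?B"
      using ad_active[of i] \<open>i < n\<close> i(2) unfolding retained_def by (cases "ad i") (auto simp: taken_Suc)
    moreover have "?G (Suc i) = ?G i" using i(2) by (auto simp: less_Suc_eq)
    ultimately have "card (taken (Suc i) \<inter> ?B) \<le> card (?G (Suc i))"
      using less.IH[OF i(1)] i(2) \<open>i < n\<close> by simp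
    then show thesis using that[of "Suc i"] i max \<open>i < n\<close> by auto
  qed
  interpret busy_phase w pos Ins Act Mk Col h c n ad \<theta> a t
    by unfold_locales (use assms(1) less.prems a in auto)
  have "?G t = ?G a \<union> {s\<in>{a..<t}. \<theta> \<le> credit s}"
    using a(1,2) by auto
  moreover have "card (?G a \<union> {s\<in>{a..<t}. \<theta> \<le> credit s}) = card (?G a) + card {s\<in>{a..<t}. \<theta> \<le> credit s}"
    by (rule card_Un_disjoint) auto
  ultimately show ?case using phase_bound a(4) unfolding big_def by simp
qed

text \<open>A retained pick pays for itself and gives a credit, together
  \<open>\<phi> * w (c s)\<close>; any other pick gives only the credit
  \<open>w (h s) \<le> \<phi> * w (c s)\<close>.\<close>

lemma taken_le_collected: "sum w (taken n) \<le> golden_ratio * sum w (Col n)"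
proof -
  let ?S = "{s. s < n \<and> \<not> idle s}"
  let ?R = "{s\<in>?S. c s \<in> retained}"
  let ?L = "{s\<in>?S. c s \<notin> retained}"
  have S: "?S = ?R \<union> ?L" "?R \<inter> ?L = {}" "finite ?R" "finite ?L" by auto
  have Col: "Col n = c ` ?S" using Col_eq[of 0 n] Col_0 by (simp add: atLeast0LessThan lessThan_def)
  have inj: "inj_on c ?S" using c_inj by (rule inj_on_subset) auto
  have "sum w (taken n - retained) \<le> sum credit ?S"
  proof (rule sum_le_sum_if_card_levels_le)
    show "0 \<le> credit s" for s
      using w_nonneg golden_ratio_gt_1 by (simp add: credit_def)
    fix \<theta> :: real assume "\<theta> > 0"
    moreover have "{x \<in> taken n - retained. \<theta> \<le> w x} = taken n \<inter> {x. x \<notin> retained \<and> \<theta> \<le> w x}" by auto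
    ultimately show "card {x \<in> taken n - retained. \<theta> \<le> w x} \<le> card {s \<in> ?S. \<theta> \<le> credit s}"
      using level_bound[of \<theta> n] by simp
  qed (use finite_taken in auto)
  also have "\<dots> = sum credit ?R + sum credit ?L" by (subst S(1), rule sum.union_disjoint) (use S in auto)
  also have "\<dots> \<le> (\<Sum>s\<in>?R. w (c s) / golden_ratio) + (\<Sum>s\<in>?L. golden_ratio * w (c s))"
    by (intro add_mono sum_mono) (auto simp: credit_def c_threshold)
  finally have 1: "sum w (taken n - retained)
    \<le> (\<Sum>s\<in>?R. w (c s) / golden_ratio) + (\<Sum>s\<in>?L. golden_ratio * w (c s))" .
  have "taken n \<inter> retained \<subseteq> c ` ?R" using retained_collected unfolding Col by blast
  then have "sum w (taken n \<inter> retained) \<le> sum w (c ` ?R)"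
    using w_nonneg by (intro sum_mono2) auto
  also have "\<dots> = (\<Sum>s\<in>?R. w (c s))"
    by (subst sum.reindex) (auto intro: inj_on_subset[OF inj])
  finally have "sum w (taken n \<inter> retained) + sum w (taken n - retained)
    \<le> (\<Sum>s\<in>?R. w (c s) + w (c s) / golden_ratio) + (\<Sum>s\<in>?L. golden_ratio * w (c s))"
    using 1 by (simp add: sum.distrib)
  also have "\<dots> = (\<Sum>s\<in>?R. golden_ratio * w (c s)) + (\<Sum>s\<in>?L. golden_ratio * w (c s))"
    by (simp add: golden_ratio_mult)
  also have "\<dots> = (\<Sum>s\<in>?S. golden_ratio * w (c s))"
    by (subst S(1), rule sum.union_disjoint[symmetric]) (use S in auto)
  also have "\<dots> = golden_ratio * sum w (Col n)"
    using inj by (simp add: Col sum.reindex sum_distrib_left)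
  finally show ?thesis
    using sum.Int_Diff[OF finite_taken, of w n retained] by simp
qed

end

section \<open>The run defined by an input\<close>

abbreviation items :: "'a queue_state \<Rightarrow> 'a list" where
  "items S \<equiv> fst S @ snd S"

text \<open>No operation drops or reorders items of \<open>D @ Q\<close>, so order properties pass
  from later states to earlier ones. Positions read off the final state therefore serve at all
  times.\<close>

lemma sorted_wrt_items_apply_op:
  "sorted_wrt P (items (apply_op u S)) \<Longrightarrow> sorted_wrt P (items S)"
proof (cases u; cases S)
  fix p x D Q assume "sorted_wrt P (items (apply_op u S))" "u = Insert p x" "S = (D, Q)"
  then have "sorted_wrt P (D @ take p Q @ drop p Q)"
    by (auto simp: sorted_wrt_append simp del: append_take_drop_id)
  then show "sorted_wrt P (items S)" using \<open>S = (D, Q)\<close> by simp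
qed auto

lemma set_apply_op:
  "set (fst S) \<subseteq> set (fst (apply_op u S))" "set (items S) \<subseteq> set (items (apply_op u S))"
proof -
  obtain D Q where S: "S = (D, Q)" by (cases S)
  have Q: "set Q = set (take p Q) \<union> set (drop p Q)" for p
    by (metis append_take_drop_id set_append)
  show "set (fst S) \<subseteq> set (fst (apply_op u S))" "set (items S) \<subseteq> set (items (apply_op u S))"
    using Q unfolding S by (cases u; auto)+
qed

lemma sorted_wrt_items_fold:
  "sorted_wrt P (items (fold apply_op ops S)) \<Longrightarrow> sorted_wrt P (items S)"
proof (induction ops arbitrary: S)
  case (Cons u ops)
  then show ?case using sorted_wrt_items_apply_op[of P u S] by simp
qed simp

lemma set_fold:
  "set (fst S) \<subseteq> set (fst (fold apply_op ops S))"
  "set (items S) \<subseteq> set (items (fold apply_op ops S))"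
proof (induction ops arbitrary: S)
  case (Cons u ops)
  { case 1 show ?case using set_apply_op(1)[of S u] Cons(1)[of "apply_op u S"] by auto }
  { case 2 show ?case using set_apply_op(2)[of S u] Cons(2)[of "apply_op u S"] by (auto simp del: set_append) }
qed simp_all

lemma state_at_later:
  assumes "t \<le> t'"
  obtains ops where "state_at I t' = fold apply_op ops (state_at I t)"
proof -
  have "take (Suc t') I = take (Suc t) I @ take (t' - t) (drop (Suc t) I)"
    using assms take_add[of "Suc t" "t' - t" I] by simp
  then show thesis using that unfolding state_at_def state_after_def by (metis concat_append fold_append comp_apply)
qed

lemma state_at_final:
  obtains ops where "state_after (concat I) = fold apply_op ops (state_at I t)"
proof -
  have "concat I = concat (take (Suc t) I) @ concat (drop (Suc t) I)"
    by (metis append_take_drop_id concat_append)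
  then show thesis using that unfolding state_at_def state_after_def by (metis fold_append comp_apply)
qed

lemma ex_position:
  assumes "distinct xs"
  obtains pos :: "'a \<Rightarrow> nat" where "sorted_wrt (\<lambda>x y. pos x < pos y) xs"
proof -
  have "\<exists>pos :: 'a \<Rightarrow> nat. sorted_wrt (\<lambda>x y. pos x < pos y) xs"
    using assms
  proof (induction xs)
    case (Cons x xs)
    then obtain pos :: "'a \<Rightarrow> nat" where pos: "sorted_wrt (\<lambda>x y. pos x < pos y) xs" by auto
    let ?pos = "\<lambda>y. if y = x then 0 else Suc (pos y)"
    have "sorted_wrt (\<lambda>y z. ?pos y < ?pos z) xs"
      using pos by (rule sorted_wrt_mono_rel[rotated]) (use Cons.prems in auto)
    then have "sorted_wrt (\<lambda>y z. ?pos y < ?pos z) (x # xs)" using Cons.prems by auto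
    then show ?case by (rule exI[of _ ?pos])
  qed simp
  then show thesis using that by blast
qed

lemma sorted_map_position:
  fixes pos :: "'a \<Rightarrow> nat" and w :: "'a \<Rightarrow> real"
  assumes "sorted_wrt (\<lambda>x y. pos x < pos y) xs" "sorted (map w xs)" "x \<in> set xs" "y \<in> set xs" "pos x < pos y"
  shows "w x \<le> w y"
  using assms by (induction xs) auto

lemma find_earliest:
  fixes pos :: "'a \<Rightarrow> nat"
  assumes "sorted_wrt (\<lambda>x y. pos x < pos y) xs" "\<exists>y\<in>set xs. P y"
  obtains x where "find P xs = Some x" "x \<in> set xs" "P x" "\<And>y. y \<in> set xs \<Longrightarrow> P y \<Longrightarrow> pos x \<le> pos y"
proof -
  have "\<exists>x. find P xs = Some x \<and> x \<in> set xs \<and> P x \<and> (\<forall>y\<in>set xs. P y \<longrightarrow> pos x \<le> pos y)"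
    using assms by (induction xs) (auto simp: less_imp_le)
  then show thesis using that by blast
qed

context
  fixes sel :: "('a \<Rightarrow> real) \<Rightarrow> 'a set \<Rightarrow> 'a" and w :: "'a \<Rightarrow> real" and I :: "'a input"
begin

definition inserted_by :: "nat \<Rightarrow> 'a set" where
  "inserted_by t = set (items (state_at I t))"

definition active_in :: "nat \<Rightarrow> 'a set" where
  "active_in t = set (snd (state_at I t))"

definition marked_before :: "nat \<Rightarrow> 'a set" where
  "marked_before t = fst (mp_run sel w I t)"

definition collected_before :: "nat \<Rightarrow> 'a set" where
  "collected_before t = {x. Some x \<in> set (snd (mp_run sel w I t))}"

definition mark :: "nat \<Rightarrow> 'a" where
  "mark t = sel w (inserted_by t - marked_before t)"

definition pick :: "nat \<Rightarrow> 'a option" where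
  "pick t = find (\<lambda>i. w i \<ge> w (mark t) / golden_ratio)
     (filter (\<lambda>x. x \<notin> collected_before t) (snd (state_at I t)))"

lemma mp_run_idle:
  "active_in t \<subseteq> collected_before t \<Longrightarrow>
    mp_run sel w I (Suc t) = (marked_before t, snd (mp_run sel w I t) @ [None])"
  unfolding active_in_def collected_before_def marked_before_def
  by (auto simp: Let_def split_beta filter_empty_conv)

lemma mp_run_busy:
  "\<not> active_in t \<subseteq> collected_before t \<Longrightarrow>
    mp_run sel w I (Suc t) = (insert (mark t) (marked_before t), snd (mp_run sel w I t) @ [pick t])"
  unfolding active_in_def collected_before_def marked_before_def mark_def pick_def inserted_by_def
  by (auto simp: Let_def split_beta filter_empty_conv)

lemma pick_earliest_pending:
  fixes pos :: "'a \<Rightarrow> nat"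
  assumes "sorted_wrt (\<lambda>x y. pos x < pos y) (items (state_at I t))"
    and "\<exists>y\<in>active_in t - collected_before t. w (mark t) / golden_ratio \<le> w y"
  shows "pick t = Some (the (pick t))" "the (pick t) \<in> active_in t - collected_before t"
    "w (mark t) / golden_ratio \<le> w (the (pick t))"
    "\<And>y. y \<in> active_in t - collected_before t \<Longrightarrow> w (mark t) / golden_ratio \<le> w y \<Longrightarrow>
      pos (the (pick t)) \<le> pos y"
proof -
  let ?Q = "filter (\<lambda>x. x \<notin> collected_before t) (snd (state_at I t))"
  have "sorted_wrt (\<lambda>x y. pos x < pos y) ?Q"
    using assms(1) by (simp add: sorted_wrt_append sorted_wrt_filter)
  moreover have Q: "set ?Q = active_in t - collected_before t" by (auto simp: active_in_def)
  ultimately obtain x where x: "pick t = Some x" "x \<in> set ?Q" "w (mark t) / golden_ratio \<le> w x"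
    "\<And>y. y \<in> set ?Q \<Longrightarrow> w (mark t) / golden_ratio \<le> w y \<Longrightarrow> pos x \<le> pos y"
    unfolding pick_def using find_earliest[of pos ?Q "\<lambda>i. w i \<ge> w (mark t) / golden_ratio"] assms(2)
    by metis
  show "pick t = Some (the (pick t))" "the (pick t) \<in> active_in t - collected_before t"
    "w (mark t) / golden_ratio \<le> w (the (pick t))"
    "\<And>y. y \<in> active_in t - collected_before t \<Longrightarrow> w (mark t) / golden_ratio \<le> w y \<Longrightarrow>
      pos (the (pick t)) \<le> pos y"
    using x Q by auto
qed

lemma mp_run_is_run:
  fixes pos :: "'a \<Rightarrow> nat"
  assumes sel: "heaviest_rule sel" and queue: "(w, I) \<in> nondecreasing_queues"
    and pos: "sorted_wrt (\<lambda>x y. pos x < pos y) (items (state_after (concat I)))"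
  shows "mark_and_pick_run w pos inserted_by active_in marked_before collected_before mark (\<lambda>t. the (pick t))"
    and "sorted_wrt (\<lambda>x y. pos x < pos y) (items (state_at I t))"
proof -
  let ?F = "state_after (concat I)"
  have "sorted (map w (items (state_after (take k (concat I)))))" for k
    using queue unfolding nondecreasing_queues_def nondecreasing_weights_def by (simp add: split_beta)
  from this[of "length (concat I)"] have sorted: "sorted (map w (items ?F))" by simp
  show pos_t: "sorted_wrt (\<lambda>x y. pos x < pos y) (items (state_at I t))" for t
    using pos sorted_wrt_items_fold state_at_final[of I t] by metis
  have final: "inserted_by t \<subseteq> set (items ?F)" for t
    using set_fold(2) state_at_final[of I t] unfolding inserted_by_def by metis
  have before: "pos x < pos y" if "x \<in> inserted_by t" "x \<notin> active_in t" "y \<in> active_in t" for x y t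
    using pos_t[of t] that unfolding inserted_by_def active_in_def sorted_wrt_append by auto
  have collected_Suc: "collected_before (Suc t) = set_option (pick t) \<union> collected_before t"
    if "\<not> active_in t \<subseteq> collected_before t" for t
    unfolding collected_before_def using mp_run_busy[OF that] by (cases "pick t") auto
  show "mark_and_pick_run w pos inserted_by active_in marked_before collected_before mark (\<lambda>t. the (pick t))"
  proof
    show "0 \<le> w x" for x using queue unfolding nondecreasing_queues_def by auto
    show "finite (inserted_by t)" for t by (simp add: inserted_by_def)
    show "active_in t \<subseteq> inserted_by t" for t by (auto simp: inserted_by_def active_in_def)
    show "inserted_by t \<subseteq> inserted_by t'" if "t \<le> t'" for t t'
      using state_at_later[OF that, of I] set_fold(2) unfolding inserted_by_def by metis
    show "x \<notin> active_in t'" if "x \<in> inserted_by t" "x \<notin> active_in t" "t \<le> t'" for x t t'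
    proof
      assume "x \<in> active_in t'"
      \<comment> \<open>The deleted part only grows, and strictly increasing positions keep it
        disjoint from the queue.\<close>
      moreover have "x \<in> set (fst (state_at I t))"
        using that(1,2) unfolding inserted_by_def active_in_def by auto
      then have "x \<in> set (fst (state_at I t'))"
        using state_at_later[OF that(3), of I] set_fold(1)[of "state_at I t"] by (metis subsetD)
      ultimately show False
        using pos_t[of t'] unfolding active_in_def sorted_wrt_append by blast
    qed
    show "pos x < pos y" if "x \<in> inserted_by t" "x \<notin> active_in t" "y \<in> active_in t" for x y t
      using before that .
    show "w x \<le> w y" if "x \<in> inserted_by t" "y \<in> inserted_by t" "pos x < pos y" for x y t
      using sorted_map_position[OF pos sorted] final that by blast
    show "marked_before 0 = {}" "collected_before 0 = {}"
      by (simp_all add: marked_before_def collected_before_def)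
    show "marked_before (Suc t) = marked_before t \<and> collected_before (Suc t) = collected_before t"
      if "active_in t \<subseteq> collected_before t" for t
      using mp_run_idle[OF that] by (simp add: marked_before_def collected_before_def)
    show "mark t \<in> inserted_by t - marked_before t \<and> (\<forall>x\<in>inserted_by t - marked_before t. w x \<le> w (mark t))"
      if "inserted_by t - marked_before t \<noteq> {}" for t
    proof -
      have "finite (inserted_by t - marked_before t)" by (simp add: inserted_by_def)
      then have "is_arg_max w (\<lambda>x. x \<in> inserted_by t - marked_before t) (mark t)"
        using sel that unfolding heaviest_rule_def mark_def by blast
      then show ?thesis unfolding is_arg_max_def by (auto simp: not_less)
    qed
    show "marked_before (Suc t) = insert (mark t) (marked_before t)"
      if "\<not> active_in t \<subseteq> collected_before t" for t
      using mp_run_busy[OF that] by (simp add: marked_before_def)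
    show "the (pick t) \<in> active_in t - collected_before t \<and>
        w (mark t) / golden_ratio \<le> w (the (pick t)) \<and>
        (\<forall>y\<in>active_in t - collected_before t.
          w (mark t) / golden_ratio \<le> w y \<longrightarrow> pos (the (pick t)) \<le> pos y) \<and>
        collected_before (Suc t) = insert (the (pick t)) (collected_before t)"
      if "\<not> active_in t \<subseteq> collected_before t"
        "\<exists>y\<in>active_in t - collected_before t. w (mark t) / golden_ratio \<le> w y" for t
      using pick_earliest_pending[OF pos_t that(2)] collected_Suc[OF that(1)]
      by (metis (no_types, lifting) insert_is_Un option.set(2))
  qed
qed

end

section \<open>Gains, the optimum and competitiveness\<close>

lemma gain_eq_sum_collected:
  assumes "\<And>s t x. s < t \<Longrightarrow> t < length C \<Longrightarrow> C ! t = Some x \<Longrightarrow> C ! s \<noteq> Some x"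
  shows "gain w C = sum w {x. Some x \<in> set C}"
  using assms
proof (induction C rule: rev_induct)
  case Nil
  then show ?case by (simp add: gain_def)
next
  case (snoc o' C)
  have "gain w C = sum w {x. Some x \<in> set C}"
  proof (rule snoc.IH)
    fix s t x assume "s < t" "t < length C" "C ! t = Some x"
    then show "C ! s \<noteq> Some x" using snoc.prems[of s t x] by (simp add: nth_append)
  qed
  moreover have fin: "finite {x. Some x \<in> set C}"
    using finite_vimageI[of "set C" Some] by (simp add: vimage_def)
  moreover have "Some x \<notin> set C" if "o' = Some x" for x
  proof
    assume "Some x \<in> set C"
    then obtain s where "s < length C" "C ! s = Some x" by (auto simp: in_set_conv_nth)
    then show False using snoc.prems[of s "length C" x] that by (simp add: nth_append)
  qed
  moreover have "{x. Some x \<in> set (C @ [o'])} = set_option o' \<union> {x. Some x \<in> set C}" by (cases o') auto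
  ultimately show ?case by (cases o') (auto simp: gain_def)
qed

lemma feasible_gain: "feasible I C \<Longrightarrow> gain w C = sum w {x. Some x \<in> set C}"
  by (rule gain_eq_sum_collected) (auto simp: feasible_def)

text \<open>This makes the \<open>Max\<close> in \<open>OPT\<close> a genuine maximum.\<close>

lemma finite_feasible: "finite {C. feasible I C}"
proof (rule finite_subset)
  let ?X = "insert None (Some ` set (items (state_after (concat I))))"
  show "{C. feasible I C} \<subseteq> {C. set C \<subseteq> ?X \<and> length C = length I}"
  proof (safe, goal_cases)
    case (1 C z)
    then obtain t where t: "t < length I" "C ! t = z" by (auto simp: feasible_def in_set_conv_nth)
    show ?case
    proof (cases z)
      case (Some x)
      then have "x \<in> set (items (state_at I t))" using 1 t by (auto simp: feasible_def)
      moreover obtain ops where "state_after (concat I) = fold apply_op ops (state_at I t)"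
        by (rule state_at_final)
      ultimately have "x \<in> set (items (state_after (concat I)))"
        using set_fold(2)[of "state_at I t" ops] by auto
      then show ?thesis using Some 1 by blast
    qed (use 1 in auto)
  qed (auto simp: feasible_def)
  show "finite {C. set C \<subseteq> ?X \<and> length C = length I}" by (rule finite_lists_length_eq) simp
qed

lemma mark_and_pick_competitive:
  assumes sel: "heaviest_rule sel" and queue: "(w, I) \<in> nondecreasing_queues"
  shows "feasible I (mark_and_pick sel w I)"
    and "feasible I C \<Longrightarrow> gain w C \<le> golden_ratio * gain w (mark_and_pick sel w I)"
proof -
  have "distinct (items (state_after (take k (concat I))))" for k
    using queue unfolding nondecreasing_queues_def valid_input_def by (simp add: split_beta)
  from this[of "length (concat I)"] have "distinct (items (state_after (concat I)))" by simp
  then obtain pos :: "'a \<Rightarrow> nat"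
    where pos: "sorted_wrt (\<lambda>x y. pos x < pos y) (items (state_after (concat I)))"
    by (rule ex_position)
  let ?c = "\<lambda>t. the (pick sel w I t)"
  interpret mark_and_pick_run w pos "inserted_by I" "active_in I" "marked_before sel w I"
    "collected_before sel w I" "mark sel w I" ?c
    using mp_run_is_run(1)[OF sel queue pos] .
  \<comment> \<open>The default \<open>None\<close> of \<open>find\<close> never occurs in a busy
    step, since a candidate exists there.\<close>
  have run: "snd (mp_run sel w I t) = map (\<lambda>s. if idle s then None else Some (?c s)) [0..<t]" for t
  proof (induction t)
    case (Suc t)
    show ?case
    proof (cases "idle t")
      case True
      then show ?thesis using Suc mp_run_idle by fastforce
    next
      case False
      have "pick sel w I t = Some (?c t)"
        using pick_earliest_pending(1)[OF mp_run_is_run(2)[OF sel queue pos]]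
          busy_step_candidate(3)[OF marks_dominate False] .
      then show ?thesis using Suc mp_run_busy[OF False] False by simp
    qed
  qed simp
  show feas: "feasible I (mark_and_pick sel w I)"
    unfolding feasible_def
  proof (intro conjI allI impI)
    show "length (mark_and_pick sel w I) = length I" by (simp add: mark_and_pick_def run)
    fix t x assume t: "t < length I" "mark_and_pick sel w I ! t = Some x"
    then have x: "\<not> idle t" "x = ?c t" by (auto simp: mark_and_pick_def run split: if_splits)
    show "x \<in> set (snd (state_at I t))" using c_pending(1)[OF x(1)] x(2) by (simp add: active_in_def)
    fix s assume s: "s < t"
    show "mark_and_pick sel w I ! s \<noteq> Some x"
    proof
      assume "mark_and_pick sel w I ! s = Some x"
      then have "\<not> idle s" "x = ?c s" using s t by (auto simp: mark_and_pick_def run split: if_splits)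
      then show False using inj_onD[OF c_inj, of s t] x s by auto
    qed
  qed
  assume C: "feasible I C"
  \<comment> \<open>Beyond the input the schedule is extended by taking nothing.\<close>
  define ad where "ad t = (if t < length I then C ! t else None)" for t
  interpret schedule_against_run w pos "inserted_by I" "active_in I" "marked_before sel w I"
    "collected_before sel w I" "mark sel w I" ?c "length I" ad
  proof
    show "x \<in> active_in I t" if "ad t = Some x" for t x
      using C that unfolding feasible_def ad_def active_in_def by (auto split: if_splits)
    show "s = t" if "ad t = Some x" "ad s = Some x" for s t x
      using C that unfolding feasible_def ad_def by (metis linorder_neqE_nat option.distinct(1))
  qed
  have "taken (length I) = {x. Some x \<in> set C}"
    using C unfolding taken_def ad_def feasible_def by (auto simp: in_set_conv_nth)
  moreover have "collected_before sel w I (length I) = {x. Some x \<in> set (mark_and_pick sel w I)}"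
    by (simp add: collected_before_def mark_and_pick_def)
  ultimately show "gain w C \<le> golden_ratio * gain w (mark_and_pick sel w I)"
    using taken_le_collected unfolding feasible_gain[OF C] feasible_gain[OF feas] by simp
qed

theorem theorem8:
  fixes sel :: "('a \<Rightarrow> real) \<Rightarrow> 'a set \<Rightarrow> 'a"
  assumes "heaviest_rule sel"
  shows "competitive_on nondecreasing_queues golden_ratio (mark_and_pick sel)"
  unfolding competitive_on_def
proof (safe, goal_cases)
  case (1 w I)
  then show ?case using mark_and_pick_competitive(1)[OF assms] by blast
next
  case (2 w I)
  note mp = mark_and_pick_competitive[OF assms 2]
  \<comment> \<open>The schedule of MarkAndPick itself witnesses that the maximum is over a nonempty
    set.\<close>
  have "OPT w I \<le> golden_ratio * gain w (mark_and_pick sel w I)"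
    unfolding OPT_def using finite_feasible mp by (intro Max.boundedI) auto
  then show ?case using golden_ratio_gt_1 by (simp add: field_simps)
qed

end
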